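(* Let $\Xi=\mathbb{R}^m$ be equipped with a metric $d$ making it a complete separable metric space, let $p\in[1,\infty)$, $\theta>0$, $\alpha\in(0,1)$, let $X\subseteq\mathbb{R}^n$ be closed and convex, let $F:\mathbb{R}^n\times\Xi\to\mathbb{R}$ be continuous, and let $\widehat\xi_1,\dots,\widehat\xi_N\in\Xi$ be samples ($N\ge 1$). Let $\mathcal{M}^\theta_N$ be the $p$-Wasserstein ball of radius $\theta$ around the empirical distribution of the samples, and let $$\widehat{X}_{\mathtt{DCP}}:=\Bigl\{x\in X \;\Big|\; \sup_{\mathbb{P}\in\mathcal{M}^\theta_N}\mathbb{P}(F(x,\xi)>0)\le\alpha\Bigr\}.$$ Define $G:\mathbb{R}^n\times\Xi\to\mathbb{R}\cup\{+\infty,-\infty\}$ by $$G(x,\widehat\xi):=\begin{cases}\inf_{\{\xi\in\Xi \,:\, F(x,\xi)>0\}} d^p(\xi,\widehat\xi), & \{\xi\in\Xi : F(x,\xi)>0\}\ne\emptyset,\\ +\infty, & \text{otherwise.}\end{cases}$$ Suppose there exists $\xi_0\in\Xi$ such that $$\limsup_{d(\xi,\xi_0)\to\infty}\frac{F(x,\xi)-F(x,\xi_0)}{d^p(\xi,\xi_0)}<\infty\qquad\text{for all } x\in X.$$ Then $$\widehat{X}_{\mathtt{DCP}}=\Bigl\{x\in X \;\Big|\; \exists\,\lambda\ge 0:\ \lambda\theta^p+\frac1N\sum_{i=1}^N s_i\le\alpha,\ \text{ where } s_i=\max\{1-\lambda G(x,\widehat\xi_i),0\}\Bigr\}.$$ In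 addition, if $\{\xi\in\Xi : F(x,\xi)>0\}$ is nonempty for every $x\in X$, then $$\widehat{X}_{\mathtt{DCP}}=\Bigl\{x\in X \;\Big|\; \frac{\theta^p}{\alpha}+\mathrm{CVaR}^{\widehat{\mathbb{P}}_N}_{1-\alpha}(-G(x,\xi))\le 0\Bigr\}.$$
   Context: $\mathcal{P}_p(\Xi)$ is the set of Borel probability measures on $\Xi$ with finite $p$-th moment. For $\mu,\nu\in\mathcal{P}_p(\Xi)$ the $p$-Wasserstein distance is given by $(W_p(\mu,\nu))^p:=\min_{\gamma}\int_{\Xi\times\Xi}d^p(\xi,\omega)\,\gamma(d\xi,d\omega)$, the minimum being over all probability measures $\gamma$ on $\Xi\times\Xi$ with marginals $\mu$ and $\nu$. The empirical distribution is $\widehat{\mathbb{P}}_N:=\frac1N\sum_{i=1}^N\delta_{\widehat\xi_i}$ and $\mathcal{M}^\theta_N:=\{\mu\in\mathcal{P}_p(\Xi) : W_p(\mu,\widehat{\mathbb{P}}_N)\le\theta\}$. For a random variable $Z$ with distribution determined by $\mathbb{P}$, $\mathrm{CVaR}^{\mathbb{P}}_{1-\alpha}(Z):=\inf_{t\in\mathbb{R}}\bigl[\alpha^{-1}\mathbb{E}_{\mathbb{P}}[(Z+t)_+]-t\bigr]$, with $z_+:=\max(z,0)$. In particular $\mathrm{CVaR}^{\widehat{\mathbb{P}}_N}_{1-\alpha}(-G(x,\xi))=\inf_{t\in\mathbb{R}}\bigl[\frac{1}{\alpha N}\sum_{i=1}^N(-G(x,\widehat\xi_i)+t)_+-t\bigr]$.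 Convention: $0\cdot(+\infty)=0$, and $\max\{1-\lambda\cdot(+\infty),0\}=0$ for $\lambda>0$. *)

theory Defs
  imports "HOL-Probability.Probability"
begin

text \<open>The metric \<open>d\<close> on \<open>\<Xi>\<close> is arbitrary, so its topology and Borel sets need not be those of the
  type-class instance.  Everything below refers to \<open>d\<close>.\<close>

definition mborel :: "('b \<Rightarrow> 'b \<Rightarrow> real) \<Rightarrow> 'b measure" where
  "mborel d = sigma UNIV {U. openin (Metric_space.mtopology UNIV d) U}"

lemma space_mborel [simp]: "space (mborel d) = UNIV"
  by (simp add: mborel_def space_measure_of_conv)

lemma sets_mborel: "sets (mborel d) = sigma_sets UNIV {U. openin (Metric_space.mtopology UNIV d) U}"
  by (simp add: mborel_def)

definition prob_measures_p :: "('b \<Rightarrow> 'b \<Rightarrow> real) \<Rightarrow> real \<Rightarrow> 'b measure set" where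
  "prob_measures_p d p =
     {\<mu>. sets \<mu> = sets (mborel d) \<and> prob_space \<mu> \<and>
         (\<exists>\<zeta>. (\<integral>\<^sup>+ \<xi>. ennreal (d \<xi> \<zeta> powr p) \<partial>\<mu>) < \<infinity>)}"

text \<open>For a separable metric the product sigma-algebra used here is the Borel sigma-algebra of the
  product topology.\<close>

definition couplings :: "('b \<Rightarrow> 'b \<Rightarrow> real) \<Rightarrow> 'b measure \<Rightarrow> 'b measure \<Rightarrow> ('b \<times> 'b) measure set" where
  "couplings d \<mu> \<nu> =
     {\<gamma>. sets \<gamma> = sets (mborel d \<Otimes>\<^sub>M mborel d) \<and> prob_space \<gamma> \<and>
         distr \<gamma> (mborel d) fst = \<mu> \<and> distr \<gamma> (mborel d) snd = \<nu>}"

text \<open>On a complete separable space the infimum over couplings is attained.  The first branch of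
  \<open>wasserstein\<close> is never taken on \<open>prob_measures_p d p\<close>.\<close>

definition transport_cost :: "('b \<Rightarrow> 'b \<Rightarrow> real) \<Rightarrow> real \<Rightarrow> 'b measure \<Rightarrow> 'b measure \<Rightarrow> ennreal" where
  "transport_cost d p \<mu> \<nu> =
     (INF \<gamma>\<in>couplings d \<mu> \<nu>. \<integral>\<^sup>+ (\<xi>, \<omega>). ennreal (d \<xi> \<omega> powr p) \<partial>\<gamma>)"

definition wasserstein :: "('b \<Rightarrow> 'b \<Rightarrow> real) \<Rightarrow> real \<Rightarrow> 'b measure \<Rightarrow> 'b measure \<Rightarrow> ennreal" where
  "wasserstein d p \<mu> \<nu> =
     (if transport_cost d p \<mu> \<nu> = \<infinity> then \<infinity>
      else ennreal (enn2real (transport_cost d p \<mu> \<nu>) powr (1 / p)))"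

definition empirical :: "('b \<Rightarrow> 'b \<Rightarrow> real) \<Rightarrow> nat \<Rightarrow> (nat \<Rightarrow> 'b) \<Rightarrow> 'b measure" where
  "empirical d N \<xi>h = distr (uniform_count_measure {1..N}) (mborel d) \<xi>h"

lemma emeasure_empirical:
  assumes "N \<ge> 1" and A: "A \<in> sets (mborel d)"
  shows "emeasure (empirical d N \<xi>h) A =
           ennreal (1 / real N) * (\<Sum>i=1..N. emeasure (return (mborel d) (\<xi>h i)) A)"
proof -
  let ?B = "\<xi>h -` A \<inter> {1..N}"
  have m: "\<xi>h \<in> measurable (uniform_count_measure {1..N}) (mborel d)"
    by (simp add: measurable_def sets_uniform_count_measure space_uniform_count_measure)
  have c: "(\<Sum>i=1..N. indicator A (\<xi>h i)) = (of_nat (card ?B) :: ennreal)"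
  proof -
    have "(\<Sum>i=1..N. indicator A (\<xi>h i)) = (\<Sum>i\<in>?B. 1 :: ennreal)"
      by (rule sum.mono_neutral_cong_right) (auto simp: indicator_def)
    then show ?thesis
      by simp
  qed
  have "emeasure (empirical d N \<xi>h) A = emeasure (uniform_count_measure {1..N}) ?B"
    using m A by (simp add: empirical_def emeasure_distr space_uniform_count_measure)
  also have "\<dots> = ennreal (real (card ?B) / real N)"
    by (subst emeasure_uniform_count_measure) auto
  also have "\<dots> = ennreal (1 / real N) * of_nat (card ?B)"
    by (simp add: ennreal_of_nat_eq_real_of_nat ennreal_mult[symmetric])
  finally show ?thesis
    using A c by simp
qed

definition wasserstein_ball ::
    "('b \<Rightarrow> 'b \<Rightarrow> real) \<Rightarrow> real \<Rightarrow> real \<Rightarrow> nat \<Rightarrow> (nat \<Rightarrow> 'b) \<Rightarrow> 'b measure set" where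
  "wasserstein_ball d p \<theta> N \<xi>h =
     {\<mu> \<in> prob_measures_p d p. wasserstein d p \<mu> (empirical d N \<xi>h) \<le> ennreal \<theta>}"

definition X_DCP ::
    "('b \<Rightarrow> 'b \<Rightarrow> real) \<Rightarrow> real \<Rightarrow> real \<Rightarrow> real \<Rightarrow> nat \<Rightarrow> (nat \<Rightarrow> 'b) \<Rightarrow> 'a set \<Rightarrow> ('a \<times> 'b \<Rightarrow> real) \<Rightarrow> 'a set"
  where
  "X_DCP d p \<theta> \<alpha> N \<xi>h X F =
     {x \<in> X. (SUP P\<in>wasserstein_ball d p \<theta> N \<xi>h. emeasure P {\<xi>. F (x, \<xi>) > 0}) \<le> ennreal \<alpha>}"

definition G_fun :: "('b \<Rightarrow> 'b \<Rightarrow> real) \<Rightarrow> real \<Rightarrow> ('a \<times> 'b \<Rightarrow> real) \<Rightarrow> 'a \<Rightarrow> 'b \<Rightarrow> ereal" where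
  "G_fun d p F x \<zeta> =
     (if {\<xi>. F (x, \<xi>) > 0} \<noteq> {}
      then (INF \<xi>\<in>{\<xi>. F (x, \<xi>) > 0}. ereal (d \<xi> \<zeta> powr p))
      else \<infinity>)"

text \<open>\<open>CVaR P \<alpha> Z\<close> is the conditional value-at-risk of \<open>Z\<close> at level \<open>1 - \<alpha>\<close>.  Since \<open>(Z + t)\<^sub>+\<close> is
  nonnegative, its expectation is a \<open>nn_integral\<close>.\<close>

definition CVaR :: "'b measure \<Rightarrow> real \<Rightarrow> ('b \<Rightarrow> ereal) \<Rightarrow> ereal" where
  "CVaR P \<alpha> Z =
     (INF t::real. ereal (1 / \<alpha>) * enn2ereal (\<integral>\<^sup>+ \<xi>. e2ennreal (max (Z \<xi> + ereal t) 0) \<partial>P) - ereal t)"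

end

theory Submission
  imports Defs
begin

text \<open>Fix \<open>x\<close> and let \<open>A = {F(x, \<cdot>) > 0}\<close>.  Whenever \<open>\<xi> \<in> A\<close> one has
  \<open>1 \<le> \<lambda> d(\<xi>, \<omega>)\<^sup>p + max (1 - \<lambda> G(x, \<omega>)) 0\<close>; integrating this against a coupling bounds \<open>P(A)\<close> by
  the dual objective.  Conversely, moving a fraction of each atom to a nearly closest point of \<open>A\<close>
  under the budget \<open>\<theta>\<^sup>p\<close> is a fractional knapsack problem, whose dual is the dual objective up to the
  error made by not attaining the distance to \<open>A\<close>; compactness in \<open>\<lambda>\<close> removes that error.  The
  substitution \<open>t = 1 / \<lambda>\<close> gives the CVaR form.\<close>

section \<open>Measurability of an arbitrary separable metric\<close>

locale full_metric_space = Metric_space UNIV d for d :: "'b \<Rightarrow> 'b \<Rightarrow> real"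
begin

lemma sets_mborel_openin: "openin mtopology U \<Longrightarrow> U \<in> sets (mborel d)"
  by (auto simp: sets_mborel intro: sigma_sets.Basic)

lemma borel_measurable_mdist_left: "(\<lambda>\<xi>. d \<xi> s) \<in> borel_measurable (mborel d)"
proof (rule borel_measurableI_less)
  fix a
  have "{\<xi> \<in> space (mborel d). d \<xi> s < a} = mball s a"
    by (auto simp: in_mball commute)
  then show "{\<xi> \<in> space (mborel d). d \<xi> s < a} \<in> sets (mborel d)"
    by (simp add: sets_mborel_openin openin_mball)
qed

text \<open>Continuity of \<open>d\<close> gives measurability for the Borel sets of the product
  topology, whereas couplings live on the product sigma-algebra. Separability bridges the two:
  strict sublevel sets become countable unions of sets defined by the one-variable functions
  \<open>d _ s\<close>.\<close>

lemma borel_measurable_mdist: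
  assumes "separable_space mtopology"
  shows "(\<lambda>z. d (fst z) (snd z)) \<in> borel_measurable (mborel d \<Otimes>\<^sub>M mborel d)"
proof (rule borel_measurableI_less)
  fix a
  let ?M = "mborel d \<Otimes>\<^sub>M mborel d"
  obtain S where S: "countable S" "mtopology closure_of S = UNIV"
    using assms by (auto simp: separable_space_def)
  note [measurable] = borel_measurable_mdist_left
  have dense: "\<exists>s\<in>S. d y s < r" if "r > 0" for y r
    using S(2) that unfolding metric_closure_of by (auto simp: in_mball set_eq_iff)
  \<comment> \<open>A point \<open>s\<close> of the dense set closer to \<open>snd z\<close> than
    half the slack \<open>a - d (fst z) (snd z)\<close> keeps the detour through \<open>s\<close>
    below \<open>a\<close>; conversely a detour is never shorter than the direct distance.\<close>
  have "{z \<in> space ?M. d (fst z) (snd z) < a} =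
        (\<Union>s\<in>S. {z \<in> space ?M. d (fst z) s + d (snd z) s < a})"
  proof (intro set_eqI iffI)
    fix z assume "z \<in> {z \<in> space ?M. d (fst z) (snd z) < a}"
    then have z: "d (fst z) (snd z) < a" by auto
    then obtain s where s: "s \<in> S" "d (snd z) s < (a - d (fst z) (snd z)) / 2"
      using dense[of "(a - d (fst z) (snd z)) / 2" "snd z"] by auto
    have "d (fst z) s \<le> d (fst z) (snd z) + d (snd z) s"
      by (rule triangle) auto
    with s z show "z \<in> (\<Union>s\<in>S. {z \<in> space ?M. d (fst z) s + d (snd z) s < a})"
      by (auto simp: space_pair_measure field_simps intro!: bexI[of _ s])
  next
    fix z assume "z \<in> (\<Union>s\<in>S. {z \<in> space ?M. d (fst z) s + d (snd z) s < a})"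
    then obtain s where "d (fst z) s + d (snd z) s < a" by auto
    moreover have "d (fst z) (snd z) \<le> d (fst z) s + d s (snd z)"
      by (rule triangle) auto
    ultimately show "z \<in> {z \<in> space ?M. d (fst z) (snd z) < a}"
      by (auto simp: space_pair_measure commute)
  qed
  also have "\<dots> \<in> sets ?M"
    using S(1) by (intro sets.countable_UN'') measurable
  finally show "{z \<in> space ?M. d (fst z) (snd z) < a} \<in> sets ?M" .
qed

end

section \<open>Weak duality\<close>

lemma nn_integral_empirical:
  assumes "f \<in> borel_measurable (mborel d)"
  shows "(\<integral>\<^sup>+ \<omega>. f \<omega> \<partial>empirical d N \<xi>h) = ennreal (1 / real N) * (\<Sum>i=1..N. f (\<xi>h i))"
proof -
  have "\<xi>h \<in> measurable (uniform_count_measure {1..N}) (mborel d)"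
    by (simp add: measurable_def sets_uniform_count_measure space_uniform_count_measure)
  then show ?thesis
    using assms
    by (simp add: empirical_def nn_integral_distr uniform_count_measure_def
        nn_integral_point_measure_finite sum_distrib_left)
qed

text \<open>Transporting to a point of \<open>A\<close> pays for the indicator of \<open>A\<close>: this is the dual feasibility
  constraint, integrated against an arbitrary coupling.\<close>

lemma (in full_metric_space) emeasure_wasserstein_ball_le:
  fixes s :: "'b \<Rightarrow> real"
  assumes sep: "separable_space mtopology" and p: "p > 0" and \<theta>: "\<theta> \<ge> 0"
    and P: "P \<in> wasserstein_ball d p \<theta> N \<xi>h"
    and A: "A \<in> sets (mborel d)" and lam: "lam \<ge> 0"
    and s: "s \<in> borel_measurable (mborel d)" "\<And>\<omega>. s \<omega> \<ge> 0"
    and dual: "\<And>\<xi> \<omega>. \<xi> \<in> A \<Longrightarrow> 1 \<le> lam * d \<xi> \<omega> powr p + s \<omega>"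
  shows "emeasure P A \<le> ennreal (lam * \<theta> powr p + (1 / real N) * (\<Sum>i=1..N. s (\<xi>h i)))"
proof -
  let ?Q = "empirical d N \<xi>h" and ?M = "mborel d \<Otimes>\<^sub>M mborel d"
  let ?S = "\<integral>\<^sup>+ \<omega>. ennreal (s \<omega>) \<partial>?Q"
  let ?T = "transport_cost d p P ?Q"
  have W: "wasserstein d p P ?Q \<le> ennreal \<theta>"
    using P by (simp add: wasserstein_ball_def)
  then have fin: "?T \<noteq> \<infinity>"
    by (auto simp: wasserstein_def top_unique split: if_splits)
  with W have "enn2real ?T powr (1 / p) \<le> \<theta>"
    using \<theta> by (simp add: wasserstein_def)
  then have "(enn2real ?T powr (1 / p)) powr p \<le> \<theta> powr p"
    using p by (intro powr_mono2) auto
  then have "enn2real ?T \<le> \<theta> powr p"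
    using p by (simp add: powr_powr)
  then have T: "?T \<le> ennreal (\<theta> powr p)"
    using fin by (cases ?T) (auto simp: ennreal_leI)
  have coupling: "emeasure P A \<le> ennreal lam * (\<integral>\<^sup>+ (\<xi>, \<omega>). ennreal (d \<xi> \<omega> powr p) \<partial>\<gamma>) + ?S"
    if "\<gamma> \<in> couplings d P ?Q" for \<gamma>
  proof -
    have [measurable_cong]: "sets \<gamma> = sets ?M"
      and P_eq: "distr \<gamma> (mborel d) fst = P" and Q_eq: "distr \<gamma> (mborel d) snd = ?Q"
      using that by (auto simp: couplings_def)
    note [measurable] = A s(1) borel_measurable_mdist[OF sep]
    have "emeasure P A = (\<integral>\<^sup>+ \<xi>. indicator A \<xi> \<partial>distr \<gamma> (mborel d) fst)"
      unfolding P_eq[symmetric] using A by simp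
    also have "\<dots> = (\<integral>\<^sup>+ z. indicator A (fst z) \<partial>\<gamma>)"
      by (rule nn_integral_distr) measurable
    also have "\<dots> \<le> (\<integral>\<^sup>+ z. ennreal lam * ennreal (d (fst z) (snd z) powr p) + ennreal (s (snd z)) \<partial>\<gamma>)"
    proof (rule nn_integral_mono)
      fix z
      show "indicator A (fst z) \<le> ennreal lam * ennreal (d (fst z) (snd z) powr p) + ennreal (s (snd z))"
        using dual[of "fst z" "snd z"] lam s(2)[of "snd z"]
        by (auto simp: indicator_def ennreal_mult[symmetric] ennreal_plus[symmetric]
            simp del: ennreal_plus)
    qed
    also have "\<dots> = ennreal lam * (\<integral>\<^sup>+ z. ennreal (d (fst z) (snd z) powr p) \<partial>\<gamma>)
        + (\<integral>\<^sup>+ z. ennreal (s (snd z)) \<partial>\<gamma>)"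
      by (subst nn_integral_add) (auto simp: nn_integral_cmult)
    also have "(\<integral>\<^sup>+ z. ennreal (s (snd z)) \<partial>\<gamma>) = ?S"
      unfolding Q_eq[symmetric] by (subst nn_integral_distr) auto
    finally show ?thesis
      by (simp add: case_prod_beta')
  qed
  have S_eq: "?S = ennreal ((1 / real N) * (\<Sum>i=1..N. s (\<xi>h i)))"
    using s by (subst nn_integral_empirical)
      (auto simp: sum_ennreal ennreal_mult[symmetric] sum_nonneg)
  show ?thesis
  proof (rule ennreal_le_epsilon)
    fix e :: real assume e: "e > 0"
    \<comment> \<open>The infimum over couplings is only approached, so some excess over
      \<open>\<theta> powr p\<close> must be allowed. Dividing \<open>e\<close> by
      \<open>lam + 1\<close> rather than by \<open>lam\<close> keeps the priced excess below
      \<open>e\<close> and also covers \<open>lam = 0\<close>.\<close>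
    define r where "r = \<theta> powr p + e / (lam + 1)"
    have "?T < ennreal r"
      using T e lam by (rule_tac le_less_trans[OF T]) (auto simp: r_def ennreal_less_iff)
    then obtain \<gamma> where \<gamma>: "\<gamma> \<in> couplings d P ?Q"
      "(\<integral>\<^sup>+ (\<xi>, \<omega>). ennreal (d \<xi> \<omega> powr p) \<partial>\<gamma>) < ennreal r"
      by (auto simp: transport_cost_def INF_less_iff)
    have "emeasure P A \<le> ennreal lam * ennreal r + ?S"
      using \<gamma>(2) by (intro order.trans[OF coupling[OF \<gamma>(1)]] add_mono mult_left_mono) auto
    also have "\<dots> = ennreal (lam * r + (1 / real N) * (\<Sum>i=1..N. s (\<xi>h i)))"
      unfolding S_eq using lam s(2) e
      by (simp add: r_def ennreal_mult[symmetric] ennreal_plus[symmetric] sum_nonneg del: ennreal_plus)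
    also have "\<dots> \<le> ennreal (lam * \<theta> powr p + (1 / real N) * (\<Sum>i=1..N. s (\<xi>h i)) + e)"
    proof (rule ennreal_leI)
      have "lam * (e / (lam + 1)) \<le> e" using lam e by (simp add: field_simps)
      then show "lam * r + (1 / real N) * (\<Sum>i=1..N. s (\<xi>h i))
          \<le> lam * \<theta> powr p + (1 / real N) * (\<Sum>i=1..N. s (\<xi>h i)) + e"
        by (simp add: r_def distrib_left)
    qed
    finally show "emeasure P A
        \<le> ennreal (lam * \<theta> powr p + (1 / real N) * (\<Sum>i=1..N. s (\<xi>h i))) + ennreal e"
      using lam s(2) e by (simp add: ennreal_plus[symmetric] sum_nonneg del: ennreal_plus)
  qed
qed

section \<open>Strong duality: fractional knapsack and the competing measure\<close>

text \<open>The multiplier is \<open>1 / t\<close>, where \<open>t\<close> is the cost of the critical item: the cheapest cost at which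
  the budget is exceeded.\<close>

lemma fractional_knapsack_duality:
  fixes c :: "'i \<Rightarrow> real"
  assumes I: "finite I" and c: "\<And>i. i \<in> I \<Longrightarrow> c i \<ge> 0" and b: "b > 0"
  obtains q lam where "\<And>i. i \<in> I \<Longrightarrow> 0 \<le> q i \<and> q i \<le> (1::real)" "(\<Sum>i\<in>I. q i * c i) \<le> b"
    "lam \<ge> 0" "lam * b + (\<Sum>i\<in>I. max (1 - lam * c i) 0) \<le> (\<Sum>i\<in>I. q i)"
proof (cases "(\<Sum>i\<in>I. c i) \<le> b")
  case True
  \<comment> \<open>All items fit into the budget, so the constraint has price zero and both
    objectives equal the number of items.\<close>
  show thesis
    by (rule that[of "\<lambda>_. 1" 0]) (use True in auto)
next
  case False
  define S where "S t = (\<Sum>i\<in>{i\<in>I. c i \<le> t}. c i)" for t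
  define T where "T = {t \<in> c ` I. S t > b}"
  have "finite T" using I by (simp add: T_def)
  have "I \<noteq> {}" using False b by auto
  have "Max (c ` I) \<in> T"
  proof -
    have "{i\<in>I. c i \<le> Max (c ` I)} = I" using I by auto
    then show ?thesis using I \<open>I \<noteq> {}\<close> False by (auto simp: T_def S_def)
  qed
  then have "T \<noteq> {}" by auto
  define t where "t = Min T"
  have t: "t \<in> T" using \<open>finite T\<close> \<open>T \<noteq> {}\<close> by (simp add: t_def)
  have t_least: "t \<le> t'" if "t' \<in> T" for t' using \<open>finite T\<close> that by (simp add: t_def)
  \<comment> \<open>Positivity makes the multiplier \<open>1 / t\<close> legitimate: items of cost
    at most zero could not exceed the positive budget.\<close>
  have "t > 0"
  proof (rule ccontr)
    assume "\<not> t > 0"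
    then have "S t \<le> 0" unfolding S_def by (intro sum_nonpos) auto
    with t b show False by (auto simp: T_def)
  qed
  define L where "L = (\<Sum>i\<in>{i\<in>I. c i < t}. c i)"
  have "L \<le> b"
  proof (cases "{i\<in>I. c i < t} = {}")
    case True
    with b show ?thesis unfolding L_def True by simp
  next
    case nonempty: False
    \<comment> \<open>The largest cost below \<open>t\<close>. Buying everything up to
      \<open>u\<close> is the same as buying everything cheaper than \<open>t\<close>, and
      minimality of \<open>t\<close> keeps \<open>u\<close> out of \<open>T\<close>, so this
      purchase stays within the budget.\<close>
    define u where "u = Max (c ` {i\<in>I. c i < t})"
    have u: "u \<in> c ` {i\<in>I. c i < t}"
      unfolding u_def using I nonempty by (intro Max_in) auto
    have "c i \<le> u" if "i \<in> I" "c i < t" for i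
      unfolding u_def using I that by (intro Max_ge) auto
    with u have "{i\<in>I. c i < t} = {i\<in>I. c i \<le> u}" by force
    then have "L = S u" by (simp add: L_def S_def)
    moreover have "u \<notin> T" using u t_least by force
    ultimately show ?thesis using u by (auto simp: T_def)
  qed
  define E where "E = (\<Sum>i\<in>{i\<in>I. c i = t}. c i)"
  have "S t = L + E"
    unfolding S_def L_def E_def using I
    by (subst sum.union_disjoint[symmetric]) (auto intro!: sum.cong)
  then have "L + E > b" using t by (auto simp: T_def)
  \<comment> \<open>All items tied at cost \<open>t\<close> are bought in the same fraction, chosen
    to spend exactly what the cheaper items leave. Here \<open>E > 0\<close>, since
    \<open>L \<le> b < L + E\<close>.\<close>
  define r where "r = (b - L) / E"
  have r: "0 \<le> r" "r \<le> 1" and rE: "L + r * E = b"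
    using \<open>L \<le> b\<close> \<open>L + E > b\<close> by (auto simp: r_def field_simps)
  define q where "q i = (if c i < t then 1 else if c i = t then r else 0)" for i
  have "(\<Sum>i\<in>I. q i * c i) =
      (\<Sum>i\<in>I. (if c i < t then c i else 0) + r * (if c i = t then c i else 0))"
    by (intro sum.cong) (auto simp: q_def)
  also have "\<dots> = L + r * E"
    by (simp only: L_def E_def sum.inter_filter[OF I] sum.distrib sum_distrib_left)
  finally have qc: "(\<Sum>i\<in>I. q i * c i) = b" using rE by simp
  \<comment> \<open>Complementary slackness: since the budget is spent exactly, equality can be
    checked item by item. The two terms add up to \<open>1\<close> below cost \<open>t\<close>, to
    \<open>r\<close> at \<open>t\<close>, and to \<open>0\<close> above it.\<close>
  have "1 / t * (\<Sum>i\<in>I. q i * c i) + (\<Sum>i\<in>I. max (1 - 1 / t * c i) 0) =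
      (\<Sum>i\<in>I. q i * c i / t + max (1 - 1 / t * c i) 0)"
    by (simp add: sum.distrib sum_divide_distrib)
  also have "\<dots> = (\<Sum>i\<in>I. q i)"
    using \<open>t > 0\<close> by (intro sum.cong) (auto simp: q_def max_def field_simps)
  finally show thesis
    using qc r \<open>t > 0\<close> by (intro that[of q "1 / t"]) (auto simp: q_def)
qed

text \<open>The competitor sends a fraction \<open>q i\<close> of the \<open>i\<close>-th atom to \<open>y i\<close> and leaves the rest in
  place.\<close>

lemma (in full_metric_space) ex_wasserstein_ball_emeasure_ge:
  assumes sep: "separable_space mtopology" and p: "p > 0" and \<theta>: "\<theta> \<ge> 0" and N: "N \<ge> 1"
    and A: "A \<in> sets (mborel d)" and y: "\<And>i. i \<in> {1..N} \<Longrightarrow> y i \<in> A"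
    and q: "\<And>i. i \<in> {1..N} \<Longrightarrow> 0 \<le> q i \<and> q i \<le> 1"
    and cost: "(\<Sum>i=1..N. q i * d (y i) (\<xi>h i) powr p) \<le> real N * \<theta> powr p"
  shows "\<exists>P\<in>wasserstein_ball d p \<theta> N \<xi>h. ennreal ((\<Sum>i=1..N. q i) / real N) \<le> emeasure P A"
proof -
  let ?B = "mborel d" and ?M = "mborel d \<Otimes>\<^sub>M mborel d" and ?Q = "empirical d N \<xi>h"
  \<comment> \<open>The coupling is the image of a finite measure on labels \<open>(i, b)\<close>,
    with \<open>b\<close> telling whether the mass is moved. Labels keep the weights apart even when
    samples or targets coincide.\<close>
  define w where "w = (\<lambda>(i, b). ennreal ((if b then q i else 1 - q i) / real N))"
  define m where "m = (\<lambda>(i, b). (if b then y i else \<xi>h i, \<xi>h i))"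
  let ?I = "point_measure ({1..N} \<times> (UNIV :: bool set)) w"
  define \<gamma> where "\<gamma> = distr ?I ?M m"
  define P where "P = distr \<gamma> ?B fst"
  have m: "m \<in> measurable ?I ?M"
    by (auto simp: measurable_def sets_point_measure space_point_measure space_pair_measure)
  have sets_\<gamma>: "sets \<gamma> = sets ?M" by (simp add: \<gamma>_def)
  note [measurable_cong] = sets_\<gamma>
  have int_\<gamma>: "(\<integral>\<^sup>+ z. f z \<partial>\<gamma>) = (\<Sum>i=1..N. ennreal (q i / real N) * f (y i, \<xi>h i)
      + ennreal ((1 - q i) / real N) * f (\<xi>h i, \<xi>h i))"
    if f: "f \<in> borel_measurable ?M" for f
  proof -
    have "(\<integral>\<^sup>+ z. f z \<partial>\<gamma>) = (\<Sum>z\<in>{1..N} \<times> UNIV. w z * f (m z))"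
      unfolding \<gamma>_def using f by (subst nn_integral_distr[OF m]) (simp_all add: nn_integral_point_measure_finite[OF finite_cartesian_product])
    also have "\<dots> = (\<Sum>i=1..N. \<Sum>b\<in>UNIV. w (i, b) * f (m (i, b)))"
      by (simp add: sum.cartesian_product)
    finally show ?thesis
      by (simp add: UNIV_bool w_def m_def add.commute)
  qed
  have weights: "ennreal (q i / real N) + ennreal ((1 - q i) / real N) = ennreal (1 / real N)"
    if "i \<in> {1..N}" for i
    using q[OF that] by (simp add: ennreal_plus[symmetric] add_divide_distrib[symmetric] del: ennreal_plus)
  have emeasure_space: "emeasure \<gamma> (space \<gamma>) = 1"
  proof -
    have "emeasure \<gamma> (space \<gamma>) = (\<integral>\<^sup>+ z. 1 \<partial>\<gamma>)" by simp
    also have "\<dots> = (\<Sum>i=1..N. ennreal (1 / real N))"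
      by (subst int_\<gamma>) (simp_all add: weights)
    also have "\<dots> = 1"
      using N by (subst sum_ennreal) auto
    finally show ?thesis .
  qed
  then have prob_\<gamma>: "prob_space \<gamma>" by (rule prob_spaceI)
  have prob_P: "prob_space P"
    unfolding P_def by (rule prob_space.prob_space_distr[OF prob_\<gamma>]) measurable
  have int_P: "(\<integral>\<^sup>+ \<xi>. f \<xi> \<partial>P) = (\<Sum>i=1..N. ennreal (q i / real N) * f (y i)
      + ennreal ((1 - q i) / real N) * f (\<xi>h i))" if [measurable]: "f \<in> borel_measurable ?B" for f
    unfolding P_def by (subst nn_integral_distr) (auto simp: int_\<gamma>)
  have snd_\<gamma>: "distr \<gamma> ?B snd = ?Q"
  proof (rule measure_eqI)
    fix S assume "S \<in> sets (distr \<gamma> ?B snd)"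
    then have S[measurable]: "S \<in> sets ?B" by simp
    have "emeasure (distr \<gamma> ?B snd) S = (\<integral>\<^sup>+ z. indicator S z \<partial>distr \<gamma> ?B snd)"
      by simp
    also have "\<dots> = (\<integral>\<^sup>+ z. indicator S (snd z) \<partial>\<gamma>)"
      by (rule nn_integral_distr) measurable
    also have "\<dots> = (\<Sum>i=1..N. ennreal (1 / real N) * indicator S (\<xi>h i))"
      by (subst int_\<gamma>) (auto simp: weights distrib_right[symmetric])
    also have "\<dots> = (\<integral>\<^sup>+ z. indicator S z \<partial>?Q)"
      by (subst nn_integral_empirical) (auto simp: sum_distrib_left)
    also have "\<dots> = emeasure ?Q S"
      using S by (simp add: empirical_def)
    finally show "emeasure (distr \<gamma> ?B snd) S = emeasure ?Q S" .
  qed (simp add: empirical_def)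
  have coupling: "\<gamma> \<in> couplings d P ?Q"
    using sets_\<gamma> prob_\<gamma> snd_\<gamma> by (simp add: couplings_def P_def)
  note [measurable] = borel_measurable_mdist[OF sep] borel_measurable_mdist_left
  \<comment> \<open>Mass left in place has cost \<open>0 powr p = 0\<close>, so only the moved
    fractions remain.\<close>
  have "(\<integral>\<^sup>+ (\<xi>, \<omega>). ennreal (d \<xi> \<omega> powr p) \<partial>\<gamma>) =
      (\<Sum>i=1..N. ennreal (q i / real N) * ennreal (d (y i) (\<xi>h i) powr p))"
    unfolding case_prod_beta' by (subst int_\<gamma>) (auto simp: mdist_zero)
  also have "\<dots> = (\<Sum>i=1..N. ennreal (q i * d (y i) (\<xi>h i) powr p / real N))"
    using q by (intro sum.cong) (auto simp: ennreal_mult[symmetric])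
  also have "\<dots> = ennreal ((\<Sum>i=1..N. q i * d (y i) (\<xi>h i) powr p) / real N)"
    unfolding sum_divide_distrib using q by (intro sum_ennreal) auto
  also have "\<dots> \<le> ennreal (\<theta> powr p)"
    using cost N by (intro ennreal_leI) (simp add: field_simps)
  finally have "transport_cost d p P ?Q \<le> ennreal (\<theta> powr p)"
    unfolding transport_cost_def by (rule INF_lower2[OF coupling])
  then have "wasserstein d p P ?Q \<le> ennreal \<theta>"
  proof (cases "transport_cost d p P ?Q" rule: ennreal_cases)
    case (real r)
    assume "transport_cost d p P ?Q \<le> ennreal (\<theta> powr p)"
    with real have "r \<le> \<theta> powr p" by simp
    then have "r powr (1 / p) \<le> (\<theta> powr p) powr (1 / p)"
      using real p by (intro powr_mono2) auto
    also have "\<dots> = \<theta>" using p \<theta> by (simp add: powr_powr)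
    finally show ?thesis using real by (simp add: wasserstein_def ennreal_leI)
  qed (simp add: top_unique)
  \<comment> \<open>\<open>P\<close> is carried by finitely many points, so its moment about any
    centre is a finite sum.\<close>
  moreover have "(\<integral>\<^sup>+ \<xi>. ennreal (d \<xi> z powr p) \<partial>P) < \<infinity>" for z
    by (subst int_P) (auto simp: ennreal_mult_less_top)
  ultimately have "P \<in> wasserstein_ball d p \<theta> N \<xi>h"
    using prob_P by (simp add: wasserstein_ball_def prob_measures_p_def P_def)
  moreover have "ennreal ((\<Sum>i=1..N. q i) / real N) \<le> emeasure P A"
  proof -
    have "ennreal ((\<Sum>i=1..N. q i) / real N) = (\<Sum>i=1..N. ennreal (q i / real N) * indicator A (y i))"
      unfolding sum_divide_distrib using q y by (subst sum_ennreal[symmetric]) auto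
    \<comment> \<open>Unmoved atoms may already lie in \<open>A\<close>; dropping them leaves a
      lower bound.\<close>
    also have "\<dots> \<le> (\<Sum>i=1..N. ennreal (q i / real N) * indicator A (y i)
        + ennreal ((1 - q i) / real N) * indicator A (\<xi>h i))"
      by (intro sum_mono) simp
    also have "\<dots> = (\<integral>\<^sup>+ \<xi>. indicator A \<xi> \<partial>P)"
      using A by (subst int_P) auto
    also have "\<dots> = emeasure P A" using A by (simp add: P_def)
    finally show ?thesis .
  qed
  ultimately show ?thesis by blast
qed

section \<open>Attainment of the multiplier and the CVaR objective\<close>

text \<open>By compactness: only \<open>\<lambda> \<in> [0, (\<alpha> + 1) / b]\<close> matters.\<close>

lemma dual_attained:
  fixes g :: "'i \<Rightarrow> real"
  assumes b: "b > 0" and \<alpha>: "\<alpha> \<ge> 0" and k: "k \<ge> 0"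
    and ex: "\<And>e. e > 0 \<Longrightarrow> \<exists>lam\<ge>0. lam * b + k * (\<Sum>i\<in>I. max (1 - lam * g i) 0) \<le> \<alpha> + e"
  shows "\<exists>lam\<ge>0. lam * b + k * (\<Sum>i\<in>I. max (1 - lam * g i) 0) \<le> \<alpha>"
proof -
  define h where "h lam = lam * b + k * (\<Sum>i\<in>I. max (1 - lam * g i) 0)" for lam
  have "continuous_on {0..(\<alpha> + 1) / b} h"
    unfolding h_def by (intro continuous_intros)
  moreover have "{0..(\<alpha> + 1) / b} \<noteq> {}" using b \<alpha> by simp
  ultimately obtain l where l: "l \<in> {0..(\<alpha> + 1) / b}" "\<And>l'. l' \<in> {0..(\<alpha> + 1) / b} \<Longrightarrow> h l \<le> h l'"
    using continuous_attains_inf[of "{0..(\<alpha> + 1) / b}" h] by auto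
  have "h l \<le> \<alpha> + e" if "e > 0" for e
  proof -
    \<comment> \<open>Capping the error at \<open>1\<close> forces
      \<open>l' * b \<le> \<alpha> + 1\<close>, which places \<open>l'\<close> in the compact
      interval where \<open>l\<close> is a minimizer.\<close>
    obtain l' where l': "l' \<ge> 0" "h l' \<le> \<alpha> + min e 1"
      using ex[of "min e 1"] \<open>e > 0\<close> by (auto simp: h_def)
    have "l' * b \<le> h l'" unfolding h_def using k by (simp add: sum_nonneg)
    with l'(2) have "l' * b \<le> \<alpha> + 1" by linarith
    then have "l' \<le> (\<alpha> + 1) / b" using b by (simp add: field_simps)
    with l(2)[of l'] l' show ?thesis by simp
  qed
  then have "h l \<le> \<alpha>" by (rule field_le_epsilon)
  with l(1) show ?thesis by (auto simp: h_def)
qed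

text \<open>Multiplying the dual constraint by \<open>t = 1 / lam\<close> and dividing by
  \<open>\<alpha>\<close> produces the CVaR objective. The right-hand side says that its infimum is
  at most \<open>- b / \<alpha>\<close> without presuming a minimizer; the backward direction
  recovers a multiplier through \<open>dual_attained\<close>.\<close>

lemma dual_iff_CVaR_objective:
  fixes g :: "'i \<Rightarrow> real"
  assumes I: "finite I" and b: "b > 0" and \<alpha>: "0 < \<alpha>" "\<alpha> < 1" and k: "k > 0" "k * real (card I) = 1"
    and g: "\<And>i. i \<in> I \<Longrightarrow> g i \<ge> 0"
  shows "(\<exists>lam\<ge>0. lam * b + k * (\<Sum>i\<in>I. max (1 - lam * g i) 0) \<le> \<alpha>) \<longleftrightarrow>
    (\<forall>e>0. \<exists>t. (1 / \<alpha>) * (k * (\<Sum>i\<in>I. max (t - g i) 0)) - t < e - b / \<alpha>)"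
proof -
  have scale: "(\<Sum>i\<in>I. max (1 - 1 / t * g i) 0) = (\<Sum>i\<in>I. max (t - g i) 0) / t" if "t > 0" for t
    unfolding sum_divide_distrib
    using that by (intro sum.cong) (auto simp: max_def field_simps)
  show ?thesis
  proof
    assume "\<exists>lam\<ge>0. lam * b + k * (\<Sum>i\<in>I. max (1 - lam * g i) 0) \<le> \<alpha>"
    then obtain lam where lam: "lam \<ge> 0" "lam * b + k * (\<Sum>i\<in>I. max (1 - lam * g i) 0) \<le> \<alpha>" by auto
    \<comment> \<open>At \<open>lam = 0\<close> the left-hand side is \<open>k * card I = 1\<close>,
      which exceeds \<open>\<alpha>\<close>.\<close>
    have "lam \<noteq> 0" using lam(2) k(2) \<alpha> by auto
    define t where "t = 1 / lam"
    have t: "t > 0" "lam = 1 / t" using lam(1) \<open>lam \<noteq> 0\<close> by (auto simp: t_def)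
    from lam(2) have "b + k * (\<Sum>i\<in>I. max (t - g i) 0) \<le> \<alpha> * t"
      unfolding t(2) scale[OF t(1)] using t(1) by (simp add: field_simps)
    then have "(b + k * (\<Sum>i\<in>I. max (t - g i) 0)) / \<alpha> \<le> t"
      using \<alpha> by (simp add: pos_divide_le_eq mult.commute)
    then have "(1 / \<alpha>) * (k * (\<Sum>i\<in>I. max (t - g i) 0)) - t \<le> - b / \<alpha>"
      by (simp add: add_divide_distrib)
    then show "\<forall>e>0. \<exists>t. (1 / \<alpha>) * (k * (\<Sum>i\<in>I. max (t - g i) 0)) - t < e - b / \<alpha>"
      by (auto intro!: exI[of _ t])
  next
    assume R: "\<forall>e>0. \<exists>t. (1 / \<alpha>) * (k * (\<Sum>i\<in>I. max (t - g i) 0)) - t < e - b / \<alpha>"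
    show "\<exists>lam\<ge>0. lam * b + k * (\<Sum>i\<in>I. max (1 - lam * g i) 0) \<le> \<alpha>"
    proof (rule dual_attained[OF b])
      fix e :: real assume e: "e > 0"
      \<comment> \<open>The first bound gives \<open>t \<ge> b / (2 * \<alpha>)\<close>, hence
        \<open>t > 0\<close>. The second gives \<open>\<alpha> * u \<le> e * t\<close>, so the error
        is at most \<open>e\<close> after division by \<open>t\<close>.\<close>
      define u where "u = min (b / (2 * \<alpha>)) (e * b / (2 * \<alpha>\<^sup>2))"
      have u: "u > 0" "u \<le> b / (2 * \<alpha>)" "u \<le> e * b / (2 * \<alpha>\<^sup>2)" using b e \<alpha> by (auto simp: u_def)
      then obtain t where t: "(1 / \<alpha>) * (k * (\<Sum>i\<in>I. max (t - g i) 0)) - t < u - b / \<alpha>"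
        using R by auto
      have "(1 / \<alpha>) * (k * (\<Sum>i\<in>I. max (t - g i) 0)) \<ge> 0"
        using \<alpha> k by (simp add: sum_nonneg)
      with t u(2) have t_ge: "t \<ge> b / (2 * \<alpha>)" by (simp add: field_simps)
      then have "t > 0" using b \<alpha> by (smt (verit) divide_pos_pos)
      have "b + k * (\<Sum>i\<in>I. max (t - g i) 0) \<le> \<alpha> * t + \<alpha> * u"
        using mult_strict_left_mono[OF t \<alpha>(1)] \<alpha> by (simp add: right_diff_distrib)
      also have "\<alpha> * u \<le> e * (b / (2 * \<alpha>))"
        using u(3) \<alpha> by (simp add: field_simps power2_eq_square)
      also have "e * (b / (2 * \<alpha>)) \<le> e * t"
        by (rule mult_left_mono) (use t_ge e in auto)
      finally have "b + k * (\<Sum>i\<in>I. max (t - g i) 0) \<le> (\<alpha> + e) * t" by (simp add: distrib_right)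
      then have "1 / t * b + k * (\<Sum>i\<in>I. max (1 - 1 / t * g i) 0) \<le> \<alpha> + e"
        unfolding scale[OF \<open>t > 0\<close>] using \<open>t > 0\<close> by (simp add: field_simps)
      with \<open>t > 0\<close> show "\<exists>lam\<ge>0. lam * b + k * (\<Sum>i\<in>I. max (1 - lam * g i) 0) \<le> \<alpha> + e"
        by (intro exI[of _ "1 / t"]) auto
    qed (use \<alpha> k in auto)
  qed
qed

section \<open>The distance to the violation set and the worst-case probability\<close>

context full_metric_space
begin

lemma openin_powr_mdist_less:
  assumes "p > 0"
  shows "openin mtopology {\<zeta>. d \<xi> \<zeta> powr p < a}"
proof (cases "a > 0")
  case True
  have "{\<zeta>. d \<xi> \<zeta> powr p < a} = mball \<xi> (a powr (1 / p))"
  proof -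
    have "r powr p < a \<longleftrightarrow> r < a powr (1 / p)" if "r \<ge> 0" for r
      using powr_less_cancel2[of p r "a powr (1 / p)"] powr_less_mono2[of p r "a powr (1 / p)"]
        True assms that by (cases "r = 0") (auto simp: powr_powr)
    then show ?thesis by (auto simp: in_mball)
  qed
  then show ?thesis by simp
next
  case False
  then have "{\<zeta>. d \<xi> \<zeta> powr p < a} = {}"
    by (auto simp: not_less intro: order.trans)
  then show ?thesis by simp
qed

text \<open>A nonempty violation set makes the infimum finite, so later arguments can work with a
  real \<open>g\<close>. Its strict sublevel sets are unions of open balls, whence measurability.
  Only approximate minimizers are provided, as the infimum need not be attained.\<close>

lemma G_fun_real:
  assumes p: "p > 0" and ne: "{\<xi>. F (x, \<xi>) > 0} \<noteq> {}"
  obtains g where "\<And>\<zeta>. G_fun d p F x \<zeta> = ereal (g \<zeta>)" "\<And>\<zeta>. g \<zeta> \<ge> 0"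
    "\<And>\<xi> \<zeta>. F (x, \<xi>) > 0 \<Longrightarrow> g \<zeta> \<le> d \<xi> \<zeta> powr p"
    "\<And>\<zeta> e. e > 0 \<Longrightarrow> \<exists>\<xi>. F (x, \<xi>) > 0 \<and> d \<xi> \<zeta> powr p < g \<zeta> + e"
    "g \<in> borel_measurable (mborel d)"
proof -
  let ?A = "{\<xi>. F (x, \<xi>) > 0}"
  define g where "g \<zeta> = real_of_ereal (G_fun d p F x \<zeta>)" for \<zeta>
  have G: "G_fun d p F x \<zeta> = (INF \<xi>\<in>?A. ereal (d \<xi> \<zeta> powr p))" for \<zeta>
    using ne by (simp add: G_fun_def)
  have nonneg: "G_fun d p F x \<zeta> \<ge> 0" for \<zeta>
    unfolding G by (rule INF_greatest) simp
  have lower: "G_fun d p F x \<zeta> \<le> ereal (d \<xi> \<zeta> powr p)" if "\<xi> \<in> ?A" for \<xi> \<zeta>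
    unfolding G by (rule INF_lower[OF that])
  have g: "G_fun d p F x \<zeta> = ereal (g \<zeta>)" for \<zeta>
    using nonneg[of \<zeta>] lower[of _ \<zeta>] ne
    by (cases "G_fun d p F x \<zeta>") (auto simp: g_def)
  have less: "g \<zeta> < a \<longleftrightarrow> (\<exists>\<xi>\<in>?A. d \<xi> \<zeta> powr p < a)" for \<zeta> a
  proof -
    have "g \<zeta> < a \<longleftrightarrow> (INF \<xi>\<in>?A. ereal (d \<xi> \<zeta> powr p)) < ereal a"
      using g[of \<zeta>] by (simp add: G)
    then show ?thesis by (simp add: INF_less_iff)
  qed
  show thesis
  proof (rule that[OF g])
    show "g \<zeta> \<ge> 0" for \<zeta> using nonneg[of \<zeta>] by (simp add: g)
    show "g \<zeta> \<le> d \<xi> \<zeta> powr p" if "F (x, \<xi>) > 0" for \<xi> \<zeta>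
      using lower[of \<xi> \<zeta>] that by (simp add: g)
    show "\<exists>\<xi>. F (x, \<xi>) > 0 \<and> d \<xi> \<zeta> powr p < g \<zeta> + e" if "e > 0" for \<zeta> e
      using less[of \<zeta> "g \<zeta> + e"] that by auto
    show "g \<in> borel_measurable (mborel d)"
    proof (rule borel_measurableI_less)
      fix a
      have "{\<zeta> \<in> space (mborel d). g \<zeta> < a} = (\<Union>\<xi>\<in>?A. {\<zeta>. d \<xi> \<zeta> powr p < a})"
        by (auto simp: less)
      also have "\<dots> \<in> sets (mborel d)"
        by (intro sets_mborel_openin openin_Union) (auto simp: openin_powr_mdist_less[OF p])
      finally show "{\<zeta> \<in> space (mborel d). g \<zeta> < a} \<in> sets (mborel d)" .
    qed
  qed
qed

text \<open>A multiplier bounds every \<open>P\<close> in the ball by weak duality with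
  \<open>s = max (1 - lam * g) 0\<close>. Conversely, the knapsack solution for nearly closest
  targets yields a measure in the ball whose probability of \<open>A\<close> dominates a dual value;
  since that probability is at most \<open>\<alpha>\<close>, so is the dual value.\<close>

lemma worst_case_probability_le_iff:
  fixes g :: "'b \<Rightarrow> real"
  assumes sep: "separable_space mtopology" and p: "p > 0" and \<theta>: "\<theta> > 0" and \<alpha>: "\<alpha> \<ge> 0"
    and N: "N \<ge> 1" and A: "A \<in> sets (mborel d)"
    and g: "g \<in> borel_measurable (mborel d)" "\<And>\<xi> \<zeta>. \<xi> \<in> A \<Longrightarrow> g \<zeta> \<le> d \<xi> \<zeta> powr p"
    and near: "\<And>\<zeta> e. e > 0 \<Longrightarrow> \<exists>\<xi>\<in>A. d \<xi> \<zeta> powr p < g \<zeta> + e"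
  shows "(SUP P\<in>wasserstein_ball d p \<theta> N \<xi>h. emeasure P A) \<le> ennreal \<alpha> \<longleftrightarrow>
    (\<exists>lam\<ge>0. lam * \<theta> powr p + 1 / real N * (\<Sum>i=1..N. max (1 - lam * g (\<xi>h i)) 0) \<le> \<alpha>)"
proof
  assume "\<exists>lam\<ge>0. lam * \<theta> powr p + 1 / real N * (\<Sum>i=1..N. max (1 - lam * g (\<xi>h i)) 0) \<le> \<alpha>"
  then obtain lam where lam: "lam \<ge> 0"
    "lam * \<theta> powr p + 1 / real N * (\<Sum>i=1..N. max (1 - lam * g (\<xi>h i)) 0) \<le> \<alpha>" by auto
  show "(SUP P\<in>wasserstein_ball d p \<theta> N \<xi>h. emeasure P A) \<le> ennreal \<alpha>"
  proof (rule SUP_least)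
    fix P assume P: "P \<in> wasserstein_ball d p \<theta> N \<xi>h"
    note [measurable] = g(1)
    have "emeasure P A \<le>
        ennreal (lam * \<theta> powr p + 1 / real N * (\<Sum>i=1..N. max (1 - lam * g (\<xi>h i)) 0))"
    proof (rule emeasure_wasserstein_ball_le[OF sep p _ P A lam(1)])
      fix \<xi> \<omega> assume "\<xi> \<in> A"
      then have "lam * g \<omega> \<le> lam * d \<xi> \<omega> powr p" using g(2) lam(1) by (intro mult_left_mono) auto
      then show "1 \<le> lam * d \<xi> \<omega> powr p + max (1 - lam * g \<omega>) 0" by linarith
    qed (use \<theta> in auto)
    also have "\<dots> \<le> ennreal \<alpha>" using lam(2) by (rule ennreal_leI)
    finally show "emeasure P A \<le> ennreal \<alpha>" .
  qed
next
  assume sup: "(SUP P\<in>wasserstein_ball d p \<theta> N \<xi>h. emeasure P A) \<le> ennreal \<alpha>"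
  have b: "\<theta> powr p > 0" using \<theta> by simp
  show "\<exists>lam\<ge>0. lam * \<theta> powr p + 1 / real N * (\<Sum>i=1..N. max (1 - lam * g (\<xi>h i)) 0) \<le> \<alpha>"
  proof (rule dual_attained[OF b \<alpha>])
    fix e :: real assume e: "e > 0"
    \<comment> \<open>The knapsack bound will give
      \<open>lam * \<theta> powr p \<le> \<alpha>\<close>, so this tolerance makes
      \<open>lam * \<delta> \<le> e\<close> although \<open>lam\<close> itself depends on
      \<open>\<delta>\<close>.\<close>
    define \<delta> where "\<delta> = e * \<theta> powr p / (\<alpha> + 1)"
    have \<delta>: "\<delta> > 0" using e b \<alpha> by (simp add: \<delta>_def)
    have "\<forall>i. \<exists>\<xi>. \<xi> \<in> A \<and> d \<xi> (\<xi>h i) powr p < g (\<xi>h i) + \<delta>"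
      using near[OF \<delta>] by blast
    then obtain y where y: "\<And>i. y i \<in> A" "\<And>i. d (y i) (\<xi>h i) powr p < g (\<xi>h i) + \<delta>"
      by metis
    let ?c = "\<lambda>i. d (y i) (\<xi>h i) powr p"
    \<comment> \<open>Every atom has mass \<open>1 / N\<close>, so the knapsack is stated for
      fractions, with the budget scaled by \<open>N\<close>.\<close>
    obtain q lam where q: "\<And>i. i \<in> {1..N} \<Longrightarrow> 0 \<le> q i \<and> q i \<le> (1::real)"
      and cost: "(\<Sum>i=1..N. q i * ?c i) \<le> real N * \<theta> powr p" and lam: "lam \<ge> 0"
      and dual: "lam * (real N * \<theta> powr p) + (\<Sum>i=1..N. max (1 - lam * ?c i) 0) \<le> (\<Sum>i=1..N. q i)"
      using fractional_knapsack_duality[of "{1..N}" ?c "real N * \<theta> powr p"] b N by auto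
    obtain P where P: "P \<in> wasserstein_ball d p \<theta> N \<xi>h"
      "ennreal ((\<Sum>i=1..N. q i) / real N) \<le> emeasure P A"
      using ex_wasserstein_ball_emeasure_ge[OF sep p _ N A y(1) q cost] \<theta> by auto
    have "ennreal ((\<Sum>i=1..N. q i) / real N) \<le> ennreal \<alpha>"
      using P sup by (meson SUP_upper order.trans)
    then have "(\<Sum>i=1..N. q i) / real N \<le> \<alpha>" using \<alpha> by simp
    with dual N have *: "lam * \<theta> powr p + (\<Sum>i=1..N. max (1 - lam * ?c i) 0) / real N \<le> \<alpha>"
      by (simp add: field_simps)
    have "lam * \<theta> powr p \<le> \<alpha>"
      using * by (smt (verit) divide_nonneg_nonneg of_nat_0_le_iff sum_nonneg)
    then have "lam * \<delta> \<le> e * (\<alpha> / (\<alpha> + 1))"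
      using e \<alpha> by (simp add: \<delta>_def divide_right_mono mult_left_mono)
    also have "\<dots> \<le> e" using e \<alpha> by (simp add: field_simps)
    finally have lam\<delta>: "lam * \<delta> \<le> e" .
    have "(\<Sum>i=1..N. max (1 - lam * g (\<xi>h i)) 0) \<le> (\<Sum>i=1..N. max (1 - lam * ?c i) 0 + e)"
    proof (rule sum_mono)
      fix i
      have "lam * ?c i \<le> lam * (g (\<xi>h i) + \<delta>)"
        using y(2)[of i] lam by (intro mult_left_mono) auto
      with lam\<delta> e show "max (1 - lam * g (\<xi>h i)) 0 \<le> max (1 - lam * ?c i) 0 + e"
        by (simp add: distrib_left)
    qed
    also have "\<dots> = (\<Sum>i=1..N. max (1 - lam * ?c i) 0) + real N * e"
      by (simp add: sum.distrib)
    finally have "1 / real N * (\<Sum>i=1..N. max (1 - lam * g (\<xi>h i)) 0) \<le>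
        (\<Sum>i=1..N. max (1 - lam * ?c i) 0) / real N + e"
      using N by (simp add: field_simps)
    with * lam show "\<exists>lam\<ge>0. lam * \<theta> powr p
        + 1 / real N * (\<Sum>i=1..N. max (1 - lam * g (\<xi>h i)) 0) \<le> \<alpha> + e"
      by (intro exI[of _ lam]) auto
  qed simp
qed

end

section \<open>Empirical CVaR and extended-real infima\<close>

lemma CVaR_empirical:
  assumes N: "N \<ge> 1" and \<alpha>: "\<alpha> > 0" and g: "g \<in> borel_measurable (mborel d)"
  shows "CVaR (empirical d N \<xi>h) \<alpha> (\<lambda>\<xi>. - ereal (g \<xi>)) =
    (INF t. ereal ((1 / \<alpha>) * (1 / real N * (\<Sum>i=1..N. max (t - g (\<xi>h i)) 0)) - t))"
proof -
  have "(\<integral>\<^sup>+ \<xi>. e2ennreal (max (- ereal (g \<xi>) + ereal t) 0) \<partial>empirical d N \<xi>h) =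
      ennreal (1 / real N * (\<Sum>i=1..N. max (t - g (\<xi>h i)) 0))" for t
  proof -
    note [measurable] = g
    have "e2ennreal (max (- ereal (g \<xi>) + ereal t) 0) = ennreal (max (t - g \<xi>) 0)" for \<xi>
      by (simp add: max_def zero_ereal_def)
    then have "(\<integral>\<^sup>+ \<xi>. e2ennreal (max (- ereal (g \<xi>) + ereal t) 0) \<partial>empirical d N \<xi>h) =
        ennreal (1 / real N) * (\<Sum>i=1..N. ennreal (max (t - g (\<xi>h i)) 0))"
      by (simp add: nn_integral_empirical)
    also have "\<dots> = ennreal (1 / real N * (\<Sum>i=1..N. max (t - g (\<xi>h i)) 0))"
      by (subst sum_ennreal) (auto simp: ennreal_mult[symmetric] sum_nonneg)
    finally show ?thesis .
  qed
  then show ?thesis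
    unfolding CVaR_def by (simp add: enn2ereal_ennreal sum_nonneg)
qed

text \<open>Removes the extended reals from the CVaR condition: the infimum may be
  \<open>-\<infinity>\<close> or fail to be attained, hence the form with \<open>e\<close>.\<close>

lemma ereal_add_INF_le_0_iff:
  "ereal c + (INF t. ereal (f t)) \<le> 0 \<longleftrightarrow> (\<forall>e>0. \<exists>t. f t < e - c)"
proof
  assume L: "ereal c + (INF t. ereal (f t)) \<le> 0"
  show "\<forall>e>0. \<exists>t. f t < e - c"
  proof (intro allI impI)
    fix e :: real assume "e > 0"
    with L have "(INF t. ereal (f t)) < ereal (e - c)"
      by (cases "INF t. ereal (f t)") auto
    then show "\<exists>t. f t < e - c" by (simp add: INF_less_iff)
  qed
next
  assume R: "\<forall>e>0. \<exists>t. f t < e - c"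
  have "(INF t. ereal (f t)) \<le> ereal (- c)"
  proof (rule ereal_le_epsilon2)
    fix e :: real assume "e > 0"
    with R obtain t where "f t < e - c" by auto
    then show "(INF t. ereal (f t)) \<le> ereal (- c) + ereal e"
      by (intro INF_lower2[of t]) auto
  qed
  then show "ereal c + (INF t. ereal (f t)) \<le> 0"
    by (cases "INF t. ereal (f t)") auto
qed

section \<open>Pointwise reduction and the empty violation set\<close>

theorem mainTheorem1:
  fixes d :: "real ^ 'm \<Rightarrow> real ^ 'm \<Rightarrow> real"
    and F :: "(real ^ 'n) \<times> (real ^ 'm) \<Rightarrow> real"
    and X :: "(real ^ 'n) set"
    and \<xi>h :: "nat \<Rightarrow> real ^ 'm"
    and p \<theta> \<alpha> :: real
    and N :: nat
  assumes metric: "Metric_space UNIV d"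
    and complete: "Metric_space.mcomplete UNIV d"
    and separable: "separable_space (Metric_space.mtopology UNIV d)"
    and p: "p \<ge> 1"
    and \<theta>: "\<theta> > 0"
    and \<alpha>: "0 < \<alpha>" "\<alpha> < 1"
    and X: "closed X" "convex X"
    and F: "continuous_map (prod_topology euclidean (Metric_space.mtopology UNIV d)) euclideanreal F"
    and N: "N \<ge> 1"
    and growth: "\<exists>\<xi>0. \<forall>x\<in>X.
      Limsup (filtercomap (\<lambda>\<xi>. d \<xi> \<xi>0) at_top)
        (\<lambda>\<xi>. ereal ((F (x, \<xi>) - F (x, \<xi>0)) / d \<xi> \<xi>0 powr p)) < \<infinity>"
  shows "X_DCP d p \<theta> \<alpha> N \<xi>h X F =
           {x \<in> X. \<exists>lam::real. lam \<ge> 0 \<and>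
              ereal (lam * \<theta> powr p) +
                ereal (1 / real N) * (\<Sum>i=1..N. max (1 - ereal lam * G_fun d p F x (\<xi>h i)) 0)
              \<le> ereal \<alpha>}
         \<and> ((\<forall>x\<in>X. {\<xi>. F (x, \<xi>) > 0} \<noteq> {}) \<longrightarrow>
             X_DCP d p \<theta> \<alpha> N \<xi>h X F =
               {x \<in> X. ereal (\<theta> powr p / \<alpha>)
                        + CVaR (empirical d N \<xi>h) \<alpha> (\<lambda>\<xi>. - G_fun d p F x \<xi>) \<le> 0})"
proof -
  interpret full_metric_space d by (simp add: full_metric_space_def metric)
  have p0: "p > 0" using p by simp
  have b: "\<theta> powr p > 0" using \<theta> by simp
  \<comment> \<open>Both set identities are settled for one \<open>x\<close> at a time, by cases on
    whether the violation set is empty.\<close>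
  define safe where "safe x \<longleftrightarrow>
    (SUP P\<in>wasserstein_ball d p \<theta> N \<xi>h. emeasure P {\<xi>. F (x, \<xi>) > 0}) \<le> ennreal \<alpha>" for x
  define dual where "dual x \<longleftrightarrow> (\<exists>lam::real. lam \<ge> 0 \<and> ereal (lam * \<theta> powr p) +
      ereal (1 / real N) * (\<Sum>i=1..N. max (1 - ereal lam * G_fun d p F x (\<xi>h i)) 0) \<le> ereal \<alpha>)" for x
  have A: "{\<xi>. F (x, \<xi>) > 0} \<in> sets (mborel d)" for x
  proof (rule sets_mborel_openin)
    have "continuous_map mtopology euclideanreal (F \<circ> (\<lambda>\<xi>. (x, \<xi>)))"
      by (rule continuous_map_compose[OF _ F]) (simp add: continuous_map_paired)
    from openin_continuous_map_preimage[OF this, of "{0<..}"]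
    show "openin mtopology {\<xi>. F (x, \<xi>) > 0}" by simp
  qed
  have nonempty: "(safe x \<longleftrightarrow> dual x) \<and> (safe x \<longleftrightarrow> ereal (\<theta> powr p / \<alpha>)
      + CVaR (empirical d N \<xi>h) \<alpha> (\<lambda>\<xi>. - G_fun d p F x \<xi>) \<le> 0)"
    if ne: "{\<xi>. F (x, \<xi>) > 0} \<noteq> {}" for x
  proof -
    obtain g where g: "\<And>\<zeta>. G_fun d p F x \<zeta> = ereal (g \<zeta>)" "\<And>\<zeta>. g \<zeta> \<ge> 0"
      "\<And>\<xi> \<zeta>. F (x, \<xi>) > 0 \<Longrightarrow> g \<zeta> \<le> d \<xi> \<zeta> powr p"
      "\<And>\<zeta> e. e > 0 \<Longrightarrow> \<exists>\<xi>. F (x, \<xi>) > 0 \<and> d \<xi> \<zeta> powr p < g \<zeta> + e"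
      "g \<in> borel_measurable (mborel d)"
      using G_fun_real[where F = F and x = x, OF p0 ne] by blast
    let ?dual = "\<exists>lam\<ge>0. lam * \<theta> powr p + 1 / real N * (\<Sum>i=1..N. max (1 - lam * g (\<xi>h i)) 0) \<le> \<alpha>"
    have "safe x \<longleftrightarrow> ?dual"
      unfolding safe_def
      by (rule worst_case_probability_le_iff[OF separable p0 \<theta> _ N A]) (use \<alpha> g in auto)
    moreover have "dual x \<longleftrightarrow> ?dual"
    proof -
      have *: "max (1 - ereal lam * G_fun d p F x (\<xi>h i)) 0 = ereal (max (1 - lam * g (\<xi>h i)) 0)" for lam i
        by (simp add: g(1) one_ereal_def zero_ereal_def max_def)
      show ?thesis
        by (simp only: dual_def * sum_ereal times_ereal.simps plus_ereal.simps ereal_less_eq)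
    qed
    moreover have "?dual \<longleftrightarrow> ereal (\<theta> powr p / \<alpha>)
      + CVaR (empirical d N \<xi>h) \<alpha> (\<lambda>\<xi>. - G_fun d p F x \<xi>) \<le> 0"
      unfolding g(1) CVaR_empirical[OF N \<alpha>(1) g(5)] ereal_add_INF_le_0_iff
      by (rule dual_iff_CVaR_objective) (use N \<alpha> b g(2) in auto)
    ultimately show ?thesis by simp
  qed
  have empty: "safe x \<and> dual x" if "{\<xi>. F (x, \<xi>) > 0} = {}" for x
  proof
    show "safe x" unfolding safe_def that by (auto intro!: SUP_least)
    \<comment> \<open>Here \<open>G_fun\<close> is infinite, so any positive multiplier makes every
      summand vanish, whereas \<open>lam = 0\<close> would leave each equal to \<open>1\<close>. The
      choice \<open>\<alpha> / \<theta> powr p\<close> meets the bound \<open>\<alpha>\<close> with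
      equality.\<close>
    have "max (1 - ereal (\<alpha> / \<theta> powr p) * G_fun d p F x (\<xi>h i)) 0 = 0" for i
      using that \<alpha> b by (simp add: G_fun_def one_ereal_def max_def)
    then show "dual x"
      unfolding dual_def using \<alpha> b by (intro exI[of _ "\<alpha> / \<theta> powr p"]) simp
  qed
  have DCP: "X_DCP d p \<theta> \<alpha> N \<xi>h X F = {x \<in> X. safe x}"
    by (simp add: X_DCP_def safe_def)
  have "safe x \<longleftrightarrow> dual x" for x
    using nonempty[of x] empty[of x] by blast
  then show ?thesis
    unfolding DCP dual_def[symmetric] using nonempty by blast
qed

end
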